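(* Let $F>0$ and $A>1$ be fixed constants, and suppose $Y=f+\xi$ with $\xi\sim N(0,\sigma^2 I_n)$. There exist positive constants $c_0,c_1,c_2$ and positive integers $n_0,M_0$, depending only on $F$ and $A$, such that the following statements hold whenever $n\ge n_0$, $M\ge M_0$ and $\log M\le c_0 n$. There exists a deterministic candidate collection $\mathcal M=\{(A_1,0),\ldots,(A_M,0)\}$ with $A_j\in\mathbb R^{n\times n}$, zero intercepts, and $\max_{1\le j\le M}\|A_j\|_{\mathrm{op}}\le A$, such that $$\inf_{\tilde f}\ \sup_{f\in\mathcal F_n(F)}\ \mathbb P_f\Big[L_n(\tilde f,f)-\inf_{w\in\mathcal W_{\mathrm C}}L_n(\hat f_{w|\mathcal M},f)\ \ge\ c_1\sigma^2\psi^{\mathrm C}_{n,M}\Big]\ \ge\ c_2.$$ For the same candidate collection $\mathcal M$, $$\inf_{\tilde f}\ \sup_{f\in\mathcal F_n(F)}\Big\{R_n(\tilde f,f)-\inf_{w\in\mathcal W_{\mathrm C}}R_n(\hat f_{w|\mathcal M},f)\Big\}\ \ge\ c_1\sigma^2\psi^{\mathrm C}_{n,M},$$ after possibly decreasing the constant $c_1$. Both infima over $\tilde f$ are over all estimators $\tilde f=\tilde f(Y)$ based on $Y$.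
   Context: Model: one observes $Y=f+\xi\in\mathbb R^n$, where $f\in\mathbb R^n$ is an unknown deterministic mean vector and $\xi$ is the noise, whose coordinates have variance $\sigma^2$; $\mathbb P_f,\mathbb E_f$ denote probability and expectation when the mean is $f$. $\|v\|_n^2=\frac1n\sum_{i=1}^n v_i^2$, and $\|\cdot\|_{\mathrm{op}}$ is the operator (spectral) norm. $\mathcal F_n(F)=\{f\in\mathbb R^n:\|f\|_n\le F\}$. An estimator is a function of $Y$ with values in $\mathbb R^n$. Loss: $L_n(\hat f,f)=\|\hat f-f\|_n^2$; risk: $R_n(\hat f,f)=\mathbb E_f\|\hat f-f\|_n^2$. For a collection $\mathcal M=\{(A_1,b_1),\ldots,(A_M,b_M)\}$ with $A_j\in\mathbb R^{n\times n}$, $b_j\in\mathbb R^n$ deterministic (here $M\ge 2$ is an integer), and $w\in\mathbb R^M$, put $A_w=\sum_j w_jA_j$, $b_w=\sum_j w_jb_j$ and $\hat f_{w|\mathcal M}=A_wY+b_w$. $\mathcal W_{\mathrm C}=\{w\in[0,1]^M:\sum_{m=1}^M w_m=1\}$ is the simplex. Rate: $\psi^{\mathrm C}_{n,M}=M/n$ if $M\le\sqrt n$, and $\psi^{\mathrm C}_{n,M}=\sqrt{\log(1+M/\sqrt n)/n}$ if $M>\sqrt n$.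
   Formalization: The constants may also depend on an arbitrary fixed upper bound for σ and are uniform over all σ below it; with constants depending only on F and A the claim fails for large σ, since the zero estimator has loss at most F². *)

theory Defs
  imports "HOL-Probability.Probability"
begin

text \<open>
  The dimension \<open>n\<close> is quantified inside the statement, so \<open>\<real>\<^sup>n\<close> is modelled by the functions
  \<open>nat \<Rightarrow> real\<close> that are extensional on \<open>{..<n}\<close>, with its Borel structure as a finite product.
  An \<open>n \<times> n\<close> matrix is a function \<open>nat \<Rightarrow> nat \<Rightarrow> real\<close> of which only the entries with
  both indices below \<open>n\<close> are ever used; a collection of size \<open>M\<close> is indexed by \<open>{..<M}\<close>.
\<close>

type_synonym rvec = "nat \<Rightarrow> real"
type_synonym rmat = "nat \<Rightarrow> nat \<Rightarrow> real"

definition Rn :: "nat \<Rightarrow> rvec measure" where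
  "Rn n = (\<Pi>\<^sub>M i\<in>{..<n}. borel)"

definition norm_n :: "nat \<Rightarrow> rvec \<Rightarrow> real" where
  "norm_n n v = sqrt ((\<Sum>i<n. (v i)\<^sup>2) / real n)"

definition mat_vec :: "nat \<Rightarrow> rmat \<Rightarrow> rvec \<Rightarrow> rvec" where
  "mat_vec n A v = (\<lambda>i\<in>{..<n}. \<Sum>j<n. A i j * v j)"

definition op_norm :: "nat \<Rightarrow> rmat \<Rightarrow> real" where
  "op_norm n A =
     (SUP v\<in>{v \<in> space (Rn n). L2_set v {..<n} \<le> 1}. L2_set (mat_vec n A v) {..<n})"

definition signal_class :: "nat \<Rightarrow> real \<Rightarrow> rvec set" where
  "signal_class n F = {f \<in> space (Rn n). norm_n n f \<le> F}"

definition gaussian_noise :: "nat \<Rightarrow> real \<Rightarrow> rvec measure" where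
  "gaussian_noise n \<sigma> = (\<Pi>\<^sub>M i\<in>{..<n}. density lborel (normal_density 0 \<sigma>))"

text \<open>The law of \<open>Y = f + \<xi>\<close>; the second argument of \<^const>\<open>normal_density\<close> is the
  standard deviation, not the variance.\<close>

definition law :: "nat \<Rightarrow> real \<Rightarrow> rvec \<Rightarrow> rvec measure" where
  "law n \<sigma> f = distr (gaussian_noise n \<sigma>) (Rn n) (\<lambda>\<xi>. \<lambda>i\<in>{..<n}. f i + \<xi> i)"

definition estimators :: "nat \<Rightarrow> (rvec \<Rightarrow> rvec) set" where
  "estimators n = measurable (Rn n) (Rn n)"

definition loss :: "nat \<Rightarrow> rvec \<Rightarrow> rvec \<Rightarrow> real" where
  "loss n g f = (norm_n n (\<lambda>i. g i - f i))\<^sup>2"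

text \<open>The risk is a nonnegative extended integral: an estimator need not have finite risk,
  and the Bochner integral would assign it the value \<open>0\<close> in that case.\<close>

definition risk :: "nat \<Rightarrow> real \<Rightarrow> (rvec \<Rightarrow> rvec) \<Rightarrow> rvec \<Rightarrow> ennreal" where
  "risk n \<sigma> g f = (\<integral>\<^sup>+ y. ennreal (loss n (g y) f) \<partial>law n \<sigma> f)"

definition simplex_weights :: "nat \<Rightarrow> (nat \<Rightarrow> real) set" where
  "simplex_weights M = {w \<in> {..<M} \<rightarrow>\<^sub>E {0..1}. (\<Sum>m<M. w m) = 1}"

definition weighted_mat :: "nat \<Rightarrow> (nat \<Rightarrow> rmat \<times> rvec) \<Rightarrow> (nat \<Rightarrow> real) \<Rightarrow> rmat" where
  "weighted_mat M C w = (\<lambda>i k. \<Sum>j<M. w j * fst (C j) i k)"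

definition weighted_vec :: "nat \<Rightarrow> (nat \<Rightarrow> rmat \<times> rvec) \<Rightarrow> (nat \<Rightarrow> real) \<Rightarrow> rvec" where
  "weighted_vec M C w = (\<lambda>i. \<Sum>j<M. w j * snd (C j) i)"

definition aggregate ::
  "nat \<Rightarrow> nat \<Rightarrow> (nat \<Rightarrow> rmat \<times> rvec) \<Rightarrow> (nat \<Rightarrow> real) \<Rightarrow> rvec \<Rightarrow> rvec" where
  "aggregate n M C w y =
     (\<lambda>i\<in>{..<n}. mat_vec n (weighted_mat M C w) y i + weighted_vec M C w i)"

definition excess_loss ::
  "nat \<Rightarrow> nat \<Rightarrow> (nat \<Rightarrow> rmat \<times> rvec) \<Rightarrow> (rvec \<Rightarrow> rvec) \<Rightarrow> rvec \<Rightarrow> rvec \<Rightarrow> real" where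
  "excess_loss n M C g f y =
     loss n (g y) f - (INF w\<in>simplex_weights M. loss n (aggregate n M C w y) f)"

text \<open>The subtracted infimum is finite, because every \<^const>\<open>aggregate\<close> has finite
  Gaussian risk; so the difference is never of the form \<open>\<infinity> - \<infinity>\<close>.\<close>

definition excess_risk ::
  "nat \<Rightarrow> nat \<Rightarrow> real \<Rightarrow> (nat \<Rightarrow> rmat \<times> rvec) \<Rightarrow> (rvec \<Rightarrow> rvec) \<Rightarrow> rvec \<Rightarrow> ereal" where
  "excess_risk n M \<sigma> C g f =
     enn2ereal (risk n \<sigma> g f)
       - enn2ereal (INF w\<in>simplex_weights M. risk n \<sigma> (aggregate n M C w) f)"

text \<open>A lower bound \<open>c\<^sub>1 \<sigma>\<^sup>2 \<cdot> convex_rate\<close> over the ball \<^const>\<open>signal_class\<close> of radius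
  \<open>F\<close> cannot have constants uniform in arbitrarily large \<open>\<sigma>\<close>, since the zero estimator has
  loss at most \<open>F\<^sup>2\<close>. Uniformity is meant over noise levels \<open>0 < \<sigma> \<le> \<sigma>max\<close> for an arbitrary
  fixed \<open>\<sigma>max\<close>.\<close>

definition convex_rate :: "nat \<Rightarrow> nat \<Rightarrow> real" where
  "convex_rate n M =
     (if real M \<le> sqrt (real n) then real M / real n
      else sqrt (ln (1 + real M / sqrt (real n)) / real n))"

end

theory Submission
  imports Defs
begin

text \<open>
  Coordinate \<open>0\<close> of the mean is a known constant \<open>\<theta> = sqrt n * F / 2\<close>, and every \<open>A\<^sub>j\<close> reads off
  only \<open>Y\<^sub>0\<close>: \<open>A\<^sub>j Y = Y\<^sub>0 (e\<^sub>0 + u\<^sub>j)\<close>, where \<open>A > 1\<close> leaves room for a small \<open>u\<^sub>j\<close>. Since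
  \<open>Y\<^sub>0\<close> is \<open>\<theta>\<close> up to a relative error of order \<open>n\<^bsup>-1/2\<^esup>\<close>,
  convex aggregation of the \<open>A\<^sub>j Y\<close> amounts to convex aggregation of the fixed vectors \<open>\<theta> u\<^sub>j\<close>, at an
  oracle loss of order \<open>\<sigma>\<^sup>2/n\<close>. Choose \<open>m\<close> blocks of \<open>d\<close> coordinates and let the \<open>u\<^sub>j\<close> be the \<open>m * 2\<^sup>d \<le> M\<close>
  scaled sign vectors supported on single blocks. Averages of one vector per block fill a whole
  cube of dimension \<open>m d\<close> with half side \<open>\<alpha> \<sigma>\<close>, where \<open>\<alpha>\<close> is a small constant; the norm constraint only
  demands \<open>d m\<^sup>2 \<le> n\<close>. Assouad's method then gives a loss of order \<open>\<sigma>\<^sup>2 m d / n\<close>, and optimizing over \<open>m\<close>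
  and \<open>d\<close> makes \<open>m d / n\<close> of the order of the rate, so the oracle loss is negligible.
\<close>

section \<open>Gaussian laws as product measures\<close>

lemma distr_plus_normal_density:
  "distr (density lborel (normal_density 0 \<sigma>)) borel ((+) a) = density lborel (normal_density a \<sigma>)"
proof -
  have "density lborel (normal_density a \<sigma>)
      = density (distr lborel borel ((+) a)) (\<lambda>x. ennreal (normal_density a \<sigma> x))"
    by (simp add: lborel_distr_plus)
  also have "\<dots> = distr (density lborel (\<lambda>x. ennreal (normal_density a \<sigma> (a + x)))) borel ((+) a)"
    by (rule density_distr) auto
  also have "(\<lambda>x. ennreal (normal_density a \<sigma> (a + x))) = (\<lambda>x. ennreal (normal_density 0 \<sigma> x))"
    by (simp add: normal_density_def)
  finally show ?thesis by simp
qed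

lemma product_prob_space_normal:
  assumes "0 < \<sigma>"
  shows "product_prob_space (\<lambda>j. density lborel (normal_density (f j) \<sigma>))"
  by (intro product_prob_spaceI prob_space_normal_density assms)

lemma sets_Rn_normal [simp]:
  "sets (\<Pi>\<^sub>M j\<in>{..<n}. density lborel (\<lambda>x. ennreal (normal_density (f j) \<sigma> x))) = sets (Rn n)"
  unfolding Rn_def by (intro sets_PiM_cong) auto

lemma space_Rn: "space (Rn n) = extensional {..<n}"
  by (auto simp: Rn_def space_PiM PiE_def)

text \<open>Finite product measures agree once they agree on boxes, and translation by
  \<open>f\<close> pulls a box back to a box with translated sides, so everything reduces to one
  coordinate.\<close>

lemma law_eq_PiM:
  assumes "0 < \<sigma>"
  shows "law n \<sigma> f = (\<Pi>\<^sub>M j\<in>{..<n}. density lborel (normal_density (f j) \<sigma>))"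
proof -
  interpret N: product_prob_space "\<lambda>j. density lborel (normal_density (f j) \<sigma>)"
    by (rule product_prob_space_normal[OF assms])
  interpret Z: product_prob_space "\<lambda>j::nat. density lborel (normal_density 0 \<sigma>)"
    by (rule product_prob_space_normal[OF assms])
  let ?T = "\<lambda>\<xi>. \<lambda>i\<in>{..<n}. f i + \<xi> i"
  have m: "?T \<in> measurable (gaussian_noise n \<sigma>) (Rn n)"
    unfolding Rn_def gaussian_noise_def by measurable
  show ?thesis
  proof (rule N.PiM_eqI)
    fix A assume A: "\<And>i. i \<in> {..<n} \<Longrightarrow> A i \<in> sets (density lborel (normal_density (f i) \<sigma>))"
    have A': "Pi\<^sub>E {..<n} A \<in> sets (Rn n)"
      unfolding Rn_def using A by (intro sets_PiM_I_finite) auto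
    have "law n \<sigma> f (Pi\<^sub>E {..<n} A)
        = emeasure (gaussian_noise n \<sigma>) (?T -` Pi\<^sub>E {..<n} A \<inter> space (gaussian_noise n \<sigma>))"
      unfolding law_def by (rule emeasure_distr[OF m A'])
    also have "?T -` Pi\<^sub>E {..<n} A \<inter> space (gaussian_noise n \<sigma>)
        = (\<Pi>\<^sub>E i\<in>{..<n}. ((+) (f i)) -` A i)"
      by (auto simp: gaussian_noise_def space_PiM PiE_def Pi_def extensional_def)
    also have "emeasure (gaussian_noise n \<sigma>) (\<Pi>\<^sub>E i\<in>{..<n}. ((+) (f i)) -` A i)
        = (\<Prod>i\<in>{..<n}. emeasure (density lborel (normal_density 0 \<sigma>)) (((+) (f i)) -` A i))"
      unfolding gaussian_noise_def
    proof (intro Z.emeasure_PiM)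
      fix i assume "i \<in> {..<n}"
      then have [measurable]: "A i \<in> sets borel" using A by auto
      have "((+) (f i)) -` A i \<inter> space borel \<in> sets borel"
        by (rule measurable_sets[of _ borel borel]) measurable
      then show "((+) (f i)) -` A i \<in> sets (density lborel (normal_density 0 \<sigma>))" by simp
    qed simp
    also have "\<dots> = (\<Prod>i\<in>{..<n}. emeasure (density lborel (normal_density (f i) \<sigma>)) (A i))"
    proof (intro prod.cong refl)
      fix i assume "i \<in> {..<n}"
      then have [measurable]: "A i \<in> sets borel" using A by auto
      show "emeasure (density lborel (normal_density 0 \<sigma>)) (((+) (f i)) -` A i)
        = emeasure (density lborel (normal_density (f i) \<sigma>)) (A i)"
        by (subst distr_plus_normal_density[symmetric], subst emeasure_distr) auto
    qed
    finally show "law n \<sigma> f (Pi\<^sub>E {..<n} A)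
      = (\<Prod>i\<in>{..<n}. emeasure (density lborel (normal_density (f i) \<sigma>)) (A i))" .
  qed (simp_all add: law_def)
qed

lemma sets_law [simp, measurable_cong]: "sets (law n \<sigma> f) = sets (Rn n)"
  by (simp add: law_def)

lemma space_law [simp]: "space (law n \<sigma> f) = space (Rn n)"
  by (simp add: law_def)

lemma prob_space_law:
  assumes "0 < \<sigma>"
  shows "prob_space (law n \<sigma> f)"
  unfolding law_eq_PiM[OF assms]
  by (intro prob_space_PiM prob_space_normal_density assms)

lemma measurable_Rn_component [measurable]:
  assumes "i < n"
  shows "(\<lambda>y. y i) \<in> borel_measurable (Rn n)"
  unfolding Rn_def using assms by (intro measurable_component_singleton) auto

lemma nn_integral_law_component:
  assumes "0 < \<sigma>" "i < n" and [measurable]: "h \<in> borel_measurable borel"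
  shows "(\<integral>\<^sup>+ y. h (y i) \<partial>law n \<sigma> f) = (\<integral>\<^sup>+ t. ennreal (normal_density (f i) \<sigma> t) * h t \<partial>lborel)"
proof -
  let ?N = "\<lambda>j. density lborel (normal_density (f j) \<sigma>)"
  have "(\<integral>\<^sup>+ y. h (y i) \<partial>law n \<sigma> f) = (\<integral>\<^sup>+ t. h t \<partial>distr (Pi\<^sub>M {..<n} ?N) (?N i) (\<lambda>y. y i))"
    using measurable_component_singleton[of i "{..<n}" ?N] assms(2)
    by (subst nn_integral_distr) (auto simp: law_eq_PiM[OF assms(1)])
  also have "distr (Pi\<^sub>M {..<n} ?N) (?N i) (\<lambda>y. y i) = ?N i"
    using assms(2) by (intro distr_PiM_component prob_space_normal_density assms(1)) auto
  finally show ?thesis by (simp add: nn_integral_density)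
qed

lemma nn_integral_law_square:
  assumes "0 < \<sigma>" "i < n"
  shows "(\<integral>\<^sup>+ y. ennreal ((y i - f i)\<^sup>2) \<partial>law n \<sigma> f) = ennreal (\<sigma>\<^sup>2)"
proof -
  have "(\<integral>\<^sup>+ y. ennreal ((y i - f i)\<^sup>2) \<partial>law n \<sigma> f)
      = (\<integral>\<^sup>+ t. ennreal (normal_density (f i) \<sigma> t * (t - f i)\<^sup>2) \<partial>lborel)"
    by (subst nn_integral_law_component[OF assms]) (auto simp: ennreal_mult')
  also have "\<dots> = ennreal (\<integral>t. normal_density (f i) \<sigma> t * (t - f i)\<^sup>2 \<partial>lborel)"
    by (intro nn_integral_eq_integral integrable_normal_moment assms(1)) auto
  also have "(\<integral>t. normal_density (f i) \<sigma> t * (t - f i)\<^sup>2 \<partial>lborel) = \<sigma>\<^sup>2"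
    using integral_normal_moment_even[OF assms(1), of "f i" 1] by simp
  finally show ?thesis .
qed

text \<open>Isolates coordinate \<open>i\<close> by Fubini: the remaining measure \<open>P\<close>
  does not see \<open>f i\<close>, so two laws that differ only there can be compared through
  one-dimensional densities. The later conclusions are the measurability facts for this
  comparison.\<close>

lemma nn_integral_law_split:
  fixes f :: rvec
  assumes "0 < \<sigma>" "i < n" and [measurable]: "h \<in> borel_measurable (Rn n)"
  defines "P \<equiv> \<Pi>\<^sub>M j\<in>{..<n} - {i}. density lborel (normal_density (f j) \<sigma>)"
  shows "(\<integral>\<^sup>+ y. h y \<partial>law n \<sigma> f)
      = (\<integral>\<^sup>+ t. ennreal (normal_density (f i) \<sigma> t) * (\<integral>\<^sup>+ x. h (x(i := t)) \<partial>P) \<partial>lborel)"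
    and "(\<lambda>t. \<integral>\<^sup>+ x. h (x(i := t)) \<partial>P) \<in> borel_measurable borel"
    and "\<And>x t. x \<in> space P \<Longrightarrow> x(i := t) \<in> space (Rn n)"
    and "\<And>t. (\<lambda>x. h (x(i := t))) \<in> borel_measurable P"
proof -
  let ?N = "\<lambda>j. density lborel (normal_density (f j) \<sigma>)"
  interpret N: product_prob_space ?N by (rule product_prob_space_normal[OF assms(1)])
  interpret P: prob_space P
    unfolding P_def by (intro prob_space_PiM prob_space_normal_density assms(1))
  have ins: "insert i ({..<n} - {i}) = {..<n}" using assms(2) by auto
  have sP [measurable_cong]: "sets P = sets (\<Pi>\<^sub>M j\<in>{..<n} - {i}. borel)"
    unfolding P_def by (intro sets_PiM_cong) auto
  have upd: "(\<lambda>(t, x). x(i := t)) \<in> measurable (borel \<Otimes>\<^sub>M P) (Rn n)"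
    unfolding Rn_def
    by (subst ins[symmetric], unfold case_prod_beta, rule measurable_fun_upd[where J = "{..<n} - {i}"])
      (auto, measurable)
  have h2: "(\<lambda>(t, x). h (x(i := t))) \<in> borel_measurable (borel \<Otimes>\<^sub>M P)"
    using measurable_compose[OF upd assms(3)] by (simp add: case_prod_beta)
  show meas: "(\<lambda>t. \<integral>\<^sup>+ x. h (x(i := t)) \<partial>P) \<in> borel_measurable borel"
    using P.borel_measurable_nn_integral[OF h2] by simp
  show "x(i := t) \<in> space (Rn n)" if "x \<in> space P" for x t
    using that assms(2) by (auto simp: P_def space_Rn space_PiM PiE_def extensional_def)
  show "(\<lambda>x. h (x(i := t))) \<in> borel_measurable P" for t
    using measurable_Pair2[OF h2, of t] by simp
  have "(\<integral>\<^sup>+ y. h y \<partial>law n \<sigma> f) = (\<integral>\<^sup>+ y. h y \<partial>Pi\<^sub>M (insert i ({..<n} - {i})) ?N)"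
    by (simp only: law_eq_PiM[OF assms(1)] ins)
  also have "\<dots> = (\<integral>\<^sup>+ t. (\<integral>\<^sup>+ x. h (x(i := t)) \<partial>P) \<partial>?N i)"
    unfolding P_def
  proof (rule N.product_nn_integral_insert_rev)
    show "h \<in> borel_measurable (Pi\<^sub>M (insert i ({..<n} - {i})) ?N)"
      unfolding ins using assms(3) by (simp cong: measurable_cong_sets)
  qed auto
  also have "\<dots> = (\<integral>\<^sup>+ t. ennreal (normal_density (f i) \<sigma> t) * (\<integral>\<^sup>+ x. h (x(i := t)) \<partial>P) \<partial>lborel)"
    using meas by (subst nn_integral_density) auto
  finally show "(\<integral>\<^sup>+ y. h y \<partial>law n \<sigma> f)
      = (\<integral>\<^sup>+ t. ennreal (normal_density (f i) \<sigma> t) * (\<integral>\<^sup>+ x. h (x(i := t)) \<partial>P) \<partial>lborel)" .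
qed

section \<open>Two-point testing and Assouad's method\<close>

text \<open>Since \<open>(y - a)\<^sup>2 \<le> 2 y\<^sup>2 + 2 a\<^sup>2\<close>, all the densities with \<open>\<bar>a\<bar> \<le> \<sigma>\<close> dominate one and the same
  multiple of the \<open>N(0, \<sigma>\<^sup>2/2)\<close> density.\<close>

lemma normal_density_ge:
  assumes "0 < \<sigma>" "\<bar>a\<bar> \<le> \<sigma>"
  shows "exp (-1) / sqrt 2 * normal_density 0 (\<sigma> / sqrt 2) y \<le> normal_density a \<sigma> y"
proof -
  have "a\<^sup>2 \<le> \<sigma>\<^sup>2" using assms by (simp add: abs_le_square_iff[symmetric])
  moreover have "(y - a)\<^sup>2 \<le> 2 * y\<^sup>2 + 2 * a\<^sup>2"
    using zero_le_power2[of "y + a"] by (simp add: power2_eq_square algebra_simps)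
  ultimately have "(y - a)\<^sup>2 / (2 * \<sigma>\<^sup>2) \<le> (2 * y\<^sup>2 + 2 * \<sigma>\<^sup>2) / (2 * \<sigma>\<^sup>2)"
    by (intro divide_right_mono) auto
  also have "\<dots> = 1 + y\<^sup>2 / \<sigma>\<^sup>2"
    using assms(1) by (simp add: field_simps)
  finally have "-1 + - (y\<^sup>2 / \<sigma>\<^sup>2) \<le> - ((y - a)\<^sup>2 / (2 * \<sigma>\<^sup>2))" by simp
  then have "exp (-1) * exp (- (y\<^sup>2 / \<sigma>\<^sup>2)) \<le> exp (- ((y - a)\<^sup>2 / (2 * \<sigma>\<^sup>2)))"
    by (simp add: exp_add[symmetric])
  moreover have "1 / sqrt (2 * pi * (\<sigma> / sqrt 2)\<^sup>2) = sqrt 2 * (1 / sqrt (2 * pi * \<sigma>\<^sup>2))"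
    by (simp add: real_sqrt_mult real_sqrt_divide power_divide)
  moreover have "2 * (\<sigma> / sqrt 2)\<^sup>2 = \<sigma>\<^sup>2" by (simp add: power_divide)
  ultimately show ?thesis
    unfolding normal_density_def using assms(1)
    by (auto intro!: mult_left_mono simp: divide_simps mult_ac)
qed

text \<open>Given coordinate \<open>i\<close>, the events \<open>E\<close> and its complement have
  probabilities \<open>h\<close> and \<open>h'\<close> over the other coordinates, with
  \<open>h + h' = 1\<close>. Both densities of coordinate \<open>i\<close> lie above the same
  multiple of a probability density, and the mass of this minorant bounds the sum from
  below.\<close>

lemma two_point_testing:
  assumes "0 < \<sigma>" "i < n" "\<bar>f i\<bar> \<le> \<sigma>" "\<bar>f' i\<bar> \<le> \<sigma>"
    and eq: "\<And>j. j < n \<Longrightarrow> j \<noteq> i \<Longrightarrow> f' j = f j"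
    and E [measurable]: "E \<in> sets (Rn n)"
  shows "exp (-1) / sqrt 2 \<le> measure (law n \<sigma> f) E + measure (law n \<sigma> f') (space (Rn n) - E)"
proof -
  interpret L: prob_space "law n \<sigma> f" by (rule prob_space_law[OF assms(1)])
  interpret L': prob_space "law n \<sigma> f'" by (rule prob_space_law[OF assms(1)])
  let ?E' = "space (Rn n) - E"
  let ?k = "exp (-1) / sqrt 2 :: real"
  let ?q = "normal_density 0 (\<sigma> / sqrt 2)"
  define P where "P = (\<Pi>\<^sub>M j\<in>{..<n} - {i}. density lborel (\<lambda>x. ennreal (normal_density (f j) \<sigma> x)))"
  \<comment> \<open>The means agree off \<open>i\<close>, so both laws share the remaining product
    measure.\<close>
  have P': "P = (\<Pi>\<^sub>M j\<in>{..<n} - {i}. density lborel (\<lambda>x. ennreal (normal_density (f' j) \<sigma> x)))"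
    unfolding P_def by (intro PiM_cong) (auto simp: eq)
  interpret P: prob_space P
    unfolding P_def by (intro prob_space_PiM prob_space_normal_density assms(1))
  have mE: "(indicator E :: _ \<Rightarrow> ennreal) \<in> borel_measurable (Rn n)"
    "(indicator ?E' :: _ \<Rightarrow> ennreal) \<in> borel_measurable (Rn n)" by measurable
  note s = nn_integral_law_split[where f = f, OF assms(1,2) mE(1), folded P_def]
  note s' = nn_integral_law_split[where f = f', OF assms(1,2) mE(2), folded P']
  define h where "h t = (\<integral>\<^sup>+ x. indicator E (x(i := t)) \<partial>P)" for t
  define h' where "h' t = (\<integral>\<^sup>+ x. indicator ?E' (x(i := t)) \<partial>P)" for t
  have [measurable]: "h \<in> borel_measurable borel" "h' \<in> borel_measurable borel"
    using s(2) s'(2) unfolding h_def h'_def by simp_all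
  have one: "h t + h' t = 1" for t
  proof -
    have "h t + h' t = (\<integral>\<^sup>+ x. indicator E (x(i := t)) + indicator ?E' (x(i := t)) \<partial>P)"
      unfolding h_def h'_def by (rule nn_integral_add[symmetric]) (rule s(4) s'(4))+
    also have "\<dots> = (\<integral>\<^sup>+ x. 1 \<partial>P)"
      using s(3) by (intro nn_integral_cong) (auto simp: indicator_def)
    finally show ?thesis by (simp add: P.emeasure_space_1)
  qed
  have pos: "0 < \<sigma> / sqrt 2" using assms(1) by simp
  have "ennreal ?k = ennreal ?k * (\<integral>\<^sup>+ t. ennreal (?q t) \<partial>lborel)"
    by (subst nn_integral_eq_integral) (auto simp: pos)
  also have "\<dots> = (\<integral>\<^sup>+ t. ennreal (?k * ?q t) * (h t + h' t) \<partial>lborel)"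
    by (subst nn_integral_cmult[symmetric]) (auto simp: one ennreal_mult'[symmetric])
  also have "\<dots> \<le> (\<integral>\<^sup>+ t. ennreal (normal_density (f i) \<sigma> t) * h t
      + ennreal (normal_density (f' i) \<sigma> t) * h' t \<partial>lborel)"
    unfolding distrib_left
    by (intro nn_integral_mono add_mono mult_right_mono ennreal_leI normal_density_ge assms) auto
  also have "\<dots> = (\<integral>\<^sup>+ t. ennreal (normal_density (f i) \<sigma> t) * h t \<partial>lborel)
      + (\<integral>\<^sup>+ t. ennreal (normal_density (f' i) \<sigma> t) * h' t \<partial>lborel)"
    by (rule nn_integral_add) auto
  also have "\<dots> = emeasure (law n \<sigma> f) E + emeasure (law n \<sigma> f') ?E'"
    unfolding h_def h'_def s(1)[symmetric] s'(1)[symmetric]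
    by (simp add: nn_integral_indicator)
  also have "\<dots> = ennreal (measure (law n \<sigma> f) E + measure (law n \<sigma> f') ?E')"
    by (simp add: L.emeasure_eq_measure L'.emeasure_eq_measure)
  finally show ?thesis by (subst (asm) ennreal_le_iff) auto
qed

text \<open>Vertices of the cube are coded by the set \<open>T\<close> of positive signs, so that
  flipping a sign amounts to inserting an element. Coordinate 0 carries the known level
  \<open>\<theta>\<close>, hence the cube coordinates run from 1 to \<open>D\<close>.\<close>

definition cube_mean :: "nat \<Rightarrow> nat \<Rightarrow> real \<Rightarrow> real \<Rightarrow> nat set \<Rightarrow> rvec" where
  "cube_mean n D \<theta> a T =
     (\<lambda>i\<in>{..<n}. if i = 0 then \<theta> else if i \<le> D then (if i \<in> T then a else - a) else 0)"

lemma estimator_component [measurable (raw)]: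
  assumes "g \<in> estimators n" "i < n"
  shows "(\<lambda>y. g y i) \<in> borel_measurable (Rn n)"
  using measurable_compose[OF _ measurable_Rn_component[OF assms(2)]] assms(1)
  by (auto simp: estimators_def)

text \<open>Average the expected number of wrong signs over the cube; since this number never exceeds \<open>D\<close>, a
  lower bound on its mean gives one on its upper tail.\<close>

lemma assouad_in_probability:
  assumes \<sigma>: "0 < \<sigma>" and a: "0 < a" "a \<le> \<sigma>" and D: "0 < D" "D < n"
    and g [measurable]: "g \<in> estimators n"
  defines "\<kappa> \<equiv> exp (-1) / sqrt 2"
  shows "\<exists>T\<subseteq>{1..D}. \<kappa> / 4 \<le> measure (law n \<sigma> (cube_mean n D \<theta> a T))
    {y \<in> space (Rn n). real D * \<kappa> / 4 * a\<^sup>2 \<le> (\<Sum>i<n. (g y i - cube_mean n D \<theta> a T i)\<^sup>2)}"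
proof (rule ccontr)
  assume contr: "\<not> ?thesis"
  let ?f = "cube_mean n D \<theta> a"
  let ?P = "\<lambda>T. law n \<sigma> (?f T)"
  have \<kappa>: "0 < \<kappa>" by (simp add: \<kappa>_def)
  \<comment> \<open>The sign of \<open>g y i\<close> serves as a test for the sign of the mean, the
    value 0 counting as a negative verdict; \<open>W i T\<close> is the event of a wrong
    verdict.\<close>
  define E where "E i = {y \<in> space (Rn n). \<not> 0 < g y i}" for i
  define W where "W i T = (if i \<in> T then E i else space (Rn n) - E i)" for i T
  define S where "S T = {y \<in> space (Rn n). real D * \<kappa> / 4 * a\<^sup>2 \<le> (\<Sum>i<n. (g y i - ?f T i)\<^sup>2)}" for T
  have mE [measurable]: "E i \<in> sets (Rn n)" if "i < n" for i
    unfolding E_def using that by measurable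
  have mW: "W i T \<in> sets (Rn n)" if "i < n" for i T
    unfolding W_def using mE[OF that] by auto
  have mS: "S T \<in> sets (Rn n)" for T
    unfolding S_def by measurable
  \<comment> \<open>Each wrong sign costs \<open>a\<^sup>2\<close>, so off \<open>S T\<close> fewer
    than \<open>D * \<kappa> / 4\<close> signs are wrong; on \<open>S T\<close> at most
    \<open>D\<close> are.\<close>
  have tail: "(\<Sum>i\<in>{1..D}. measure (?P T) (W i T)) \<le> real D * \<kappa> / 4 + real D * measure (?P T) (S T)" for T
  proof -
    interpret L: prob_space "?P T" by (rule prob_space_law[OF \<sigma>])
    have pw: "(\<Sum>i\<in>{1..D}. indicator (W i T) y) \<le> real D * \<kappa> / 4 + real D * indicator (S T) y"
      if y: "y \<in> space (Rn n)" for y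
    proof -
      let ?N = "\<Sum>i\<in>{1..D}. indicator (W i T) y :: real"
      have "?N \<le> real D" using sum_mono[of "{1..D}" "\<lambda>i. indicator (W i T) y :: real" "\<lambda>_. 1"]
        by (simp add: indicator_def)
      moreover have "y \<in> S T" if "real D * \<kappa> / 4 \<le> ?N"
      proof -
        have "real D * \<kappa> / 4 * a\<^sup>2 \<le> ?N * a\<^sup>2" using that by (intro mult_right_mono) auto
        also have "\<dots> = (\<Sum>i\<in>{1..D}. indicator (W i T) y * a\<^sup>2)" by (simp add: sum_distrib_right)
        also have "\<dots> \<le> (\<Sum>i\<in>{1..D}. (g y i - ?f T i)\<^sup>2)"
        proof (rule sum_mono)
          fix i assume i: "i \<in> {1..D}"
          have "a \<le> \<bar>g y i - ?f T i\<bar>" if "y \<in> W i T"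
            using that i D a by (auto simp: W_def E_def cube_mean_def split: if_splits)
          then show "indicator (W i T) y * a\<^sup>2 \<le> (g y i - ?f T i)\<^sup>2"
            using a by (auto simp: indicator_def abs_le_square_iff[symmetric])
        qed
        also have "\<dots> \<le> (\<Sum>i<n. (g y i - ?f T i)\<^sup>2)"
          using D by (intro sum_mono2) auto
        finally show ?thesis using y by (simp add: S_def)
      qed
      ultimately show ?thesis
        using \<kappa> D by (cases "y \<in> S T"; cases "real D * \<kappa> / 4 \<le> ?N") (simp_all add: add_increasing)
    qed
    have int: "integrable (?P T) (indicator A :: _ \<Rightarrow> real)" if "A \<in> sets (Rn n)" for A
      using that by (simp add: L.emeasure_eq_measure)
    have W: "W i T \<in> sets (Rn n)" if "i \<in> {1..D}" for i using mW that D by auto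
    have "(\<Sum>i\<in>{1..D}. measure (?P T) (W i T)) = (\<Sum>i\<in>{1..D}. (\<integral>y. indicator (W i T) y \<partial>?P T))"
      using W by (intro sum.cong) auto
    also have "\<dots> = (\<integral>y. (\<Sum>i\<in>{1..D}. indicator (W i T) y) \<partial>?P T)"
      using W by (intro Bochner_Integration.integral_sum[symmetric] int) auto
    also have "\<dots> \<le> (\<integral>y. real D * \<kappa> / 4 + real D * indicator (S T) y \<partial>?P T)"
      using pw W mS
      by (intro integral_mono Bochner_Integration.integrable_sum Bochner_Integration.integrable_add
          integrable_mult_right int) auto
    also have "\<dots> = real D * \<kappa> / 4 + real D * measure (?P T) (S T)"
      using int[OF mS, of T] mS[of T] L.prob_space
      by (subst Bochner_Integration.integral_add) auto
    finally show ?thesis .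
  qed
  \<comment> \<open>Pair each \<open>T\<close> without \<open>i\<close> with
    \<open>insert i T\<close>: there are \<open>2 ^ (D - 1)\<close> pairs, and two-point testing
    applies to each.\<close>
  have flip: "2 ^ (D - 1) * \<kappa> \<le> (\<Sum>T\<in>Pow {1..D}. measure (?P T) (W i T))" if i: "i \<in> {1..D}" for i
  proof -
    let ?B = "{1..D} - {i}"
    have ins: "{1..D} = insert i ?B" using i by auto
    have inj: "inj_on (insert i) (Pow ?B)" by (auto simp: inj_on_def)
    have "2 ^ (D - 1) * \<kappa> = (\<Sum>T\<in>Pow ?B. \<kappa>)" using i by (simp add: card_Pow)
    also have "\<dots> \<le> (\<Sum>T\<in>Pow ?B. measure (?P (insert i T)) (E i) + measure (?P T) (space (Rn n) - E i))"
      unfolding \<kappa>_def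
    proof (intro sum_mono two_point_testing[OF \<sigma>])
      show "i < n" using i D by simp
    qed (use i a D in \<open>auto simp: cube_mean_def\<close>)
    also have "\<dots> = (\<Sum>T\<in>Pow ?B. measure (?P (insert i T)) (W i (insert i T)) + measure (?P T) (W i T))"
      by (intro sum.cong refl) (auto simp: W_def)
    also have "\<dots> = (\<Sum>T\<in>insert i ` Pow ?B. measure (?P T) (W i T)) + (\<Sum>T\<in>Pow ?B. measure (?P T) (W i T))"
      unfolding sum.reindex[OF inj] sum.distrib comp_def ..
    also have "\<dots> = (\<Sum>T\<in>insert i ` Pow ?B \<union> Pow ?B. measure (?P T) (W i T))"
      by (intro sum.union_disjoint[symmetric]) auto
    also have "insert i ` Pow ?B \<union> Pow ?B = Pow {1..D}"
      by (subst (3) ins, subst Pow_insert) auto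
    finally show ?thesis .
  qed
  \<comment> \<open>Averaged over the \<open>2 ^ D\<close> vertices, \<open>flip\<close> gives at
    least \<open>D * \<kappa> / 2\<close> wrong signs, while \<open>tail\<close> and the negated
    claim keep the average strictly below that.\<close>
  have "real D * (2 ^ (D - 1) * \<kappa>) = (\<Sum>i\<in>{1..D}. 2 ^ (D - 1) * \<kappa>)" by simp
  also have "\<dots> \<le> (\<Sum>i\<in>{1..D}. \<Sum>T\<in>Pow {1..D}. measure (?P T) (W i T))"
    by (intro sum_mono flip)
  also have "\<dots> = (\<Sum>T\<in>Pow {1..D}. \<Sum>i\<in>{1..D}. measure (?P T) (W i T))" by (rule sum.swap)
  also have "\<dots> < (\<Sum>T\<in>Pow {1..D}. real D * \<kappa> / 2)"
  proof (intro sum_strict_mono)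
    fix T assume "T \<in> Pow {1..D}"
    then have "measure (?P T) (S T) < \<kappa> / 4" using contr by (auto simp: S_def not_le)
    then have "real D * measure (?P T) (S T) < real D * (\<kappa> / 4)" using D by simp
    with tail[of T] show "(\<Sum>i\<in>{1..D}. measure (?P T) (W i T)) < real D * \<kappa> / 2" by simp
  qed auto
  also have "\<dots> = 2 ^ D * (real D * \<kappa> / 2)" by (simp add: card_Pow)
  also have "\<dots> = real D * (2 ^ (D - 1) * \<kappa>)" using D by (cases D) (auto simp: field_simps)
  finally show False by simp
qed

section \<open>Sign cubes in convex hulls and rank-one matrices\<close>

lemma loss_eq: "loss n g f = (\<Sum>i<n. (g i - f i)\<^sup>2) / real n"
  by (simp add: loss_def norm_n_def sum_nonneg)

text \<open>The vectors are \<open>m\<close> times the sign vectors supported on one of \<open>m\<close> blocks of \<open>d\<close> coordinates.\<close>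

lemma sign_cube_in_convex_hull:
  fixes m d M :: nat
  assumes m: "0 < m" and card_le: "m * 2 ^ d \<le> M"
  shows "\<exists>V :: nat \<Rightarrow> nat \<Rightarrow> real.
    (\<forall>j. (\<Sum>i\<in>{1..m * d}. (V j i)\<^sup>2) \<le> (real m)\<^sup>2 * real d) \<and>
    (\<forall>T\<subseteq>{1..m * d}. \<exists>w\<in>simplex_weights M. \<forall>i\<in>{1..m * d}.
        (\<Sum>j<M. w j * V j i) = (if i \<in> T then 1 else - 1))"
proof -
  \<comment> \<open>Blocks start at 1 because coordinate 0 is reserved for the known level.\<close>
  define B where "B l = {l * d + 1..l * d + d}" for l
  \<comment> \<open>A pair is a block with its set of positive signs; \<open>p\<close> numbers the
    \<open>m * 2 ^ d\<close> pairs by indices below \<open>M\<close>. Indices missed by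
    \<open>p\<close> receive the zero vector.\<close>
  define I where "I = Sigma {..<m} (\<lambda>l. Pow (B l))"
  have "finite I" unfolding I_def B_def by auto
  moreover have "card I = m * 2 ^ d"
    unfolding I_def B_def by (subst card_SigmaI) (auto simp: card_Pow)
  ultimately obtain p where p: "p ` I \<subseteq> {..<M}" "inj_on p I"
    using card_le_inj[of I "{..<M}"] card_le by auto
  define V :: "nat \<Rightarrow> nat \<Rightarrow> real" where
    "V j i = (if j \<in> p ` I \<and> i \<in> B (fst (inv_into I p j))
      then (if i \<in> snd (inv_into I p j) then real m else - real m) else 0)" for j i
  have V_p: "V (p (l, S)) i = (if i \<in> B l then (if i \<in> S then real m else - real m) else 0)"
    if "(l, S) \<in> I" for l S i
    using that p(2) by (simp add: V_def)
  have "(\<Sum>i\<in>{1..m * d}. (V j i)\<^sup>2) \<le> (real m)\<^sup>2 * real d" for j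
  proof -
    let ?B = "B (fst (inv_into I p j))"
    have "(\<Sum>i\<in>{1..m * d}. (V j i)\<^sup>2) \<le> (\<Sum>i\<in>{1..m * d}. if i \<in> ?B then (real m)\<^sup>2 else 0)"
      by (intro sum_mono) (simp add: V_def)
    also have "\<dots> = (\<Sum>i\<in>{1..m * d} \<inter> ?B. (real m)\<^sup>2)"
      by (subst sum.inter_restrict) auto
    also have "\<dots> \<le> (\<Sum>i\<in>?B. (real m)\<^sup>2)"
      by (intro sum_mono2) (auto simp: B_def)
    also have "\<dots> = (real m)\<^sup>2 * real d" by (simp add: B_def)
    finally show ?thesis .
  qed
  moreover have "\<exists>w\<in>simplex_weights M. \<forall>i\<in>{1..m * d}.
      (\<Sum>j<M. w j * V j i) = (if i \<in> T then 1 else - 1)" if T: "T \<subseteq> {1..m * d}" for T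
  proof -
    \<comment> \<open>Uniform weights on the \<open>m\<close> vectors whose block pattern is that of
      \<open>T\<close>: \<open>1 / m\<close> cancels the height \<open>m\<close> of
      \<open>V\<close>. Writing \<open>w\<close> as a sum over blocks lets the two summations be
      swapped.\<close>
    define w where "w = (\<lambda>j\<in>{..<M}. \<Sum>l<m. if j = p (l, T \<inter> B l) then 1 / real m else 0)"
    have mem: "(l, T \<inter> B l) \<in> I" "p (l, T \<inter> B l) < M" if "l < m" for l
    proof -
      show "(l, T \<inter> B l) \<in> I" using that by (auto simp: I_def)
      then have "p (l, T \<inter> B l) \<in> p ` I" by (rule imageI)
      then show "p (l, T \<inter> B l) < M" using p(1) by auto
    qed
    have w_sum: "(\<Sum>j<M. w j * x j) = (\<Sum>l<m. x (p (l, T \<inter> B l)) / real m)" for x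
    proof -
      have "(\<Sum>j<M. w j * x j) = (\<Sum>j<M. \<Sum>l<m. if j = p (l, T \<inter> B l) then x j / real m else 0)"
        by (intro sum.cong refl) (auto simp: w_def sum_distrib_right intro!: sum.cong)
      also have "\<dots> = (\<Sum>l<m. \<Sum>j<M. if j = p (l, T \<inter> B l) then x j / real m else 0)"
        by (rule sum.swap)
      also have "\<dots> = (\<Sum>l<m. x (p (l, T \<inter> B l)) / real m)"
        using mem(2) by (intro sum.cong refl) (simp add: sum.delta')
      finally show ?thesis .
    qed
    have w0: "0 \<le> w j" if "j < M" for j
      using that by (auto simp: w_def intro!: sum_nonneg)
    have w1: "(\<Sum>j<M. w j) = 1" using w_sum[of "\<lambda>_. 1"] m by simp
    have "w j \<le> 1" if "j < M" for j
      using member_le_sum[of j "{..<M}" w] w0 w1 that by auto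
    then have "w \<in> simplex_weights M"
      using w0 w1 by (auto simp: simplex_weights_def w_def)
    moreover have "(\<Sum>j<M. w j * V j i) = (if i \<in> T then 1 else - 1)" if i: "i \<in> {1..m * d}" for i
    proof -
      \<comment> \<open>The blocks partition \<open>{1..m * d}\<close>, so exactly one of the
        \<open>m\<close> chosen vectors is nonzero at \<open>i\<close>; its block number is read off
        after a shift by 1.\<close>
      define k where "k = (i - 1) div d"
      have d: "0 < d" using i by (cases d) auto
      have "i - 1 < m * d" using i by (simp only: atLeastAtMost_iff) linarith
      then have k: "k < m" unfolding k_def by (rule less_mult_imp_div_less)
      have iB: "i \<in> B l \<longleftrightarrow> l = k" for l
      proof
        assume "i \<in> B l"
        then have "i - 1 = l * d + (i - 1 - l * d)" "i - 1 - l * d < d" by (auto simp: B_def)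
        then show "l = k" unfolding k_def
          by (metis add.commute add_0 div_less div_mult_self1 d less_numeral_extra(3) mult.commute)
      next
        assume "l = k"
        moreover have "k * d + (i - 1) mod d = i - 1" unfolding k_def by simp
        moreover have "(i - 1) mod d < d" using d by simp
        ultimately show "i \<in> B l" using i unfolding B_def by auto
      qed
      have "(\<Sum>j<M. w j * V j i) = (\<Sum>l<m. if l = k then (if i \<in> T then 1 else - 1) else 0)"
        unfolding w_sum using m mem(1) by (intro sum.cong refl) (auto simp: V_p iB)
      also have "\<dots> = (if i \<in> T then 1 else - 1)" using k by simp
      finally show ?thesis .
    qed
    ultimately show ?thesis by blast
  qed
  ultimately show ?thesis by blast
qed

text \<open>The outer product of \<open>u\<close> with the unit vector of index 0. Convex
  combinations keep this form, so an aggregate is again governed by a single column.\<close>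

definition first_coordinate_mat :: "rvec \<Rightarrow> rmat" where
  "first_coordinate_mat u = (\<lambda>i k. if k = 0 then u i else 0)"

lemma mat_vec_first_coordinate_mat:
  assumes "i < n"
  shows "mat_vec n (first_coordinate_mat u) v i = v 0 * u i"
proof -
  have "(\<Sum>k<n. (if k = 0 then u i else 0) * v k) = (\<Sum>k<n. if k = 0 then v 0 * u i else 0)"
    by (rule sum.cong) auto
  then show ?thesis using assms by (simp add: mat_vec_def first_coordinate_mat_def)
qed

text \<open>A vector \<open>v\<close> is sent to \<open>v 0\<close> times \<open>u\<close>, and
  \<open>\<bar>v 0\<bar>\<close> is at most the Euclidean norm of \<open>v\<close>.\<close>

lemma op_norm_first_coordinate_mat_le:
  assumes "0 < n"
  shows "op_norm n (first_coordinate_mat u) \<le> L2_set u {..<n}"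
  unfolding op_norm_def
proof (rule cSUP_least)
  have "(\<lambda>i\<in>{..<n}. 0) \<in> {v \<in> space (Rn n). L2_set v {..<n} \<le> 1}"
    by (simp add: Rn_def space_PiM L2_set_def)
  then show "{v \<in> space (Rn n). L2_set v {..<n} \<le> 1} \<noteq> {}" by blast
next
  fix v assume "v \<in> {v \<in> space (Rn n). L2_set v {..<n} \<le> 1}"
  then have v: "L2_set v {..<n} \<le> 1" by simp
  have "\<bar>v 0\<bar> \<le> L2_set (\<lambda>i. \<bar>v i\<bar>) {..<n}"
    using assms by (intro member_le_L2_set) auto
  also have "\<dots> = L2_set v {..<n}" by (simp add: L2_set_def)
  finally have v0: "\<bar>v 0\<bar> \<le> 1" using v by linarith
  have "L2_set (mat_vec n (first_coordinate_mat u) v) {..<n} = L2_set (\<lambda>i. v 0 * u i) {..<n}"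
    by (intro L2_set_cong) (auto simp: mat_vec_first_coordinate_mat)
  also have "\<dots> = \<bar>v 0\<bar> * L2_set u {..<n}"
    by (simp add: L2_set_def power_mult_distrib sum_distrib_left[symmetric] real_sqrt_mult)
  also have "\<bar>v 0\<bar> * L2_set u {..<n} \<le> 1 * L2_set u {..<n}"
    using v0 by (intro mult_right_mono) auto
  finally show "L2_set (mat_vec n (first_coordinate_mat u) v) {..<n} \<le> L2_set u {..<n}" by simp
qed

lemma aggregate_first_coordinate_mat:
  assumes "i < n"
  shows "aggregate n M (\<lambda>j. (first_coordinate_mat (u j), \<lambda>_. 0)) w y i = y 0 * (\<Sum>j<M. w j * u j i)"
proof -
  have "weighted_mat M (\<lambda>j. (first_coordinate_mat (u j), \<lambda>_. 0)) w
      = first_coordinate_mat (\<lambda>i. \<Sum>j<M. w j * u j i)"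
    by (auto simp: weighted_mat_def first_coordinate_mat_def fun_eq_iff)
  then show ?thesis
    using assms by (simp add: aggregate_def weighted_vec_def mat_vec_first_coordinate_mat)
qed

section \<open>Measurability of the oracle loss\<close>

text \<open>An infimum of continuous functions is upper semicontinuous, so it is Borel even though the index
  set is uncountable.\<close>

lemma borel_measurable_cINF_continuous:
  fixes h :: "'a \<Rightarrow> 'b :: topological_space \<Rightarrow> real"
  assumes W: "W \<noteq> {}" and cont: "\<And>w. w \<in> W \<Longrightarrow> continuous_on UNIV (h w)"
    and lower: "\<And>w t. w \<in> W \<Longrightarrow> b \<le> h w t"
  shows "(\<lambda>t. INF w\<in>W. h w t) \<in> borel_measurable borel"
  unfolding borel_measurable_iff_less
proof (intro allI)
  fix c
  have "(INF w\<in>W. h w t) < c \<longleftrightarrow> (\<exists>w\<in>W. h w t < c)" for t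
    using W lower by (intro cINF_less_iff bdd_belowI2) auto
  then have "{t. (INF w\<in>W. h w t) < c} = (\<Union>w\<in>W. {t. h w t < c})" by auto
  moreover have "open {t. h w t < c}" if "w \<in> W" for w
    using cont[OF that] by (intro open_Collect_less) auto
  ultimately have "open {t. (INF w\<in>W. h w t) < c}" by auto
  then show "{t \<in> space borel. (INF w\<in>W. h w t) < c} \<in> sets borel" by simp
qed

lemma simplex_weights_nonempty:
  assumes "0 < M"
  shows "simplex_weights M \<noteq> {}"
proof -
  have "(\<lambda>j\<in>{..<M}. if j = 0 then 1 else 0) \<in> simplex_weights M"
    using assms by (auto simp: simplex_weights_def)
  then show ?thesis by blast
qed

text \<open>The aggregates see \<open>y\<close> only through \<open>y 0\<close>, so the infimum is a
  function of one real variable, of the kind treated by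
  \<open>borel_measurable_cINF_continuous\<close>.\<close>

lemma borel_measurable_oracle_loss:
  assumes "0 < n" "0 < M"
  shows "(\<lambda>y. INF w\<in>simplex_weights M.
      loss n (aggregate n M (\<lambda>j. (first_coordinate_mat (u j), \<lambda>_. 0)) w y) f) \<in> borel_measurable (Rn n)"
proof -
  define h where "h w t = (\<Sum>i<n. (t * (\<Sum>j<M. w j * u j i) - f i)\<^sup>2) / real n" for w :: "nat \<Rightarrow> real" and t :: real
  have "(\<lambda>t. INF w\<in>simplex_weights M. h w t) \<in> borel_measurable borel"
    unfolding h_def
    by (rule borel_measurable_cINF_continuous[where b = 0])
      (use assms in \<open>auto intro!: continuous_intros sum_nonneg simplex_weights_nonempty divide_nonneg_nonneg\<close>)
  moreover have "(\<lambda>y. y 0) \<in> borel_measurable (Rn n)"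
    unfolding Rn_def using assms by (intro measurable_component_singleton) auto
  ultimately have "(\<lambda>y. INF w\<in>simplex_weights M. h w (y 0)) \<in> borel_measurable (Rn n)"
    by (rule measurable_compose[rotated])
  moreover have "loss n (aggregate n M (\<lambda>j. (first_coordinate_mat (u j), \<lambda>_. 0)) w y) f = h w (y 0)" for w y
    by (simp add: loss_eq h_def aggregate_first_coordinate_mat)
  ultimately show ?thesis by simp
qed

section \<open>The rate and the block parameters\<close>

lemma ln_2_ge_half: "1 / 2 \<le> ln (2 :: real)"
  using ln_ge_iff[of 2 "1/2"] exp_bound[of "1/2"] by (simp add: power2_eq_square)

lemma scaled_convex_rate:
  assumes "0 < n" "sqrt (real n) < real M"
  shows "real n * convex_rate n M = sqrt (real n * ln (1 + real M / sqrt (real n)))"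
proof -
  have "real n * convex_rate n M
      = real n / sqrt (real n) * sqrt (ln (1 + real M / sqrt (real n)))"
    using assms by (simp add: convex_rate_def real_sqrt_divide)
  then show ?thesis using assms by (simp add: real_div_sqrt real_sqrt_mult)
qed

text \<open>Serves to force a large cube dimension. In the sparse regime the scaled rate is
  \<open>M\<close>; in the dense one the logarithm is at least \<open>ln 2 \<ge> 1 / 2\<close>, so
  the scaled rate is at least \<open>sqrt (n / 2)\<close>.\<close>

lemma scaled_convex_rate_ge:
  assumes "0 < n" "0 \<le> K" "K \<le> real M" "2 * K\<^sup>2 \<le> real n"
  shows "K \<le> real n * convex_rate n M"
proof (cases "real M \<le> sqrt (real n)")
  case True
  then show ?thesis using assms by (simp add: convex_rate_def)
next
  case False
  have "ln 2 \<le> ln (1 + real M / sqrt (real n))"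
    using False assms by (subst ln_le_cancel_iff) (auto simp: le_divide_eq add_pos_nonneg)
  then have "1 / 2 \<le> ln (1 + real M / sqrt (real n))" using ln_2_ge_half by linarith
  then have "real n * (1 / 2) \<le> real n * ln (1 + real M / sqrt (real n))"
    by (intro mult_left_mono) auto
  then have "K\<^sup>2 \<le> real n * ln (1 + real M / sqrt (real n))" using assms(4) by simp
  then show ?thesis
    using False assms by (subst scaled_convex_rate) (auto intro: real_le_rsqrt)
qed

text \<open>In the dense regime the number \<open>d\<close> of bits per block is of order \<open>log (M / sqrt n)\<close> and the number
  of blocks is of order \<open>sqrt (n / d)\<close>.\<close>

lemma block_parameters:
  assumes n: "32 \<le> n" and M: "2 \<le> M" and lnM: "ln (real M) \<le> real n / 64"
  obtains m d where "0 < m" "0 < d" "m * 2 ^ d \<le> M" "real d * (real m)\<^sup>2 \<le> real n" "m * d < n"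
    "real n * convex_rate n M \<le> 6 * real (m * d)"
proof (cases "real M \<le> sqrt (real n)")
  \<comment> \<open>Sparse regime: with one bit per block, \<open>M div 2\<close> blocks fit, and
    halving with rounding loses a factor of at most 3.\<close>
  case True
  have "(real M)\<^sup>2 \<le> real n" 
    using True power_mono[of "real M" "sqrt (real n)" 2] by simp
  moreover have "real (M div 2) \<le> real M" by simp
  then have "(real (M div 2))\<^sup>2 \<le> (real M)\<^sup>2" by (intro power_mono) auto
  ultimately have sq: "(real (M div 2))\<^sup>2 \<le> real n" by linarith
  have "real M * 1 \<le> (real M)\<^sup>2" unfolding power2_eq_square using M by (intro mult_left_mono) auto
  with \<open>(real M)\<^sup>2 \<le> real n\<close> have "M \<le> n" by simp
  then have lt: "M div 2 < n" using M by simp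
  have rate: "real n * convex_rate n M = real M" using True n by (simp add: convex_rate_def)
  have "M \<le> 6 * (M div 2)" using M by presburger
  then have "real M \<le> 6 * real (M div 2 * 1)" by linarith
  then show ?thesis using sq lt rate M by (intro that[of "M div 2" 1]) auto
next
  case False
  define x where "x = real M / sqrt (real n)"
  \<comment> \<open>\<open>d\<close> is the base-2 logarithm of \<open>2 * x\<close> rounded down,
    the factor 2 ensuring \<open>d \<ge> 1\<close>. The real \<open>s\<close> is the largest with
    \<open>d * s\<^sup>2 \<le> n\<close>; halving it gives \<open>m \<le> sqrt n / 2\<close> and
    hence \<open>m * 2 ^ d \<le> M\<close>.\<close>
  define y where "y = log 2 (2 * x)"
  define d where "d = nat \<lfloor>y\<rfloor>"
  define s where "s = sqrt (real n / real d)"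
  define m where "m = nat \<lfloor>s / 2\<rfloor>"
  have n0: "0 < sqrt (real n)" "1 \<le> sqrt (real n)" using n by auto
  have x: "1 < x" using False n0 by (simp add: x_def)
  have y: "y = 1 + log 2 x" unfolding y_def using x by (simp add: log_mult)
  then have y1: "1 < y" using x by simp
  have d: "1 \<le> d" "real d \<le> y" "y < real d + 1" unfolding d_def using y1 by linarith+
  have "2 ^ d = 2 powr real d" by (simp add: powr_realpow)
  also have "\<dots> \<le> 2 powr y" using d by simp
  also have "\<dots> = 2 * x" unfolding y_def using x by simp
  finally have pow: "2 ^ d \<le> 2 * x" .
  have "x \<le> real M" unfolding x_def using n0 by (simp add: divide_le_eq mult_le_cancel_left1)
  then have "log 2 x \<le> log 2 (real M)" using x M by simp
  also have "\<dots> = ln (real M) / ln 2" by (simp add: log_def)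
  also have "\<dots> \<le> ln (real M) / (1 / 2)" using ln_2_ge_half M by (intro divide_left_mono) auto
  also have "\<dots> \<le> real n / 32" using lnM by simp
  \<comment> \<open>Uses \<open>y = 1 + log 2 x\<close> and \<open>1 \<le> n / 32\<close>. The bound
    yields \<open>s \<ge> 4\<close>, so rounding \<open>s / 2\<close> down still leaves at least
    \<open>s / 4\<close>.\<close>
  finally have "real d \<le> real n / 16" using y d n by linarith
  then have "16 \<le> real n / real d" using d by (simp add: field_simps)
  then have s4: "4 \<le> s" unfolding s_def by (intro real_le_rsqrt) simp
  have m: "real m \<le> s / 2" "s / 2 < real m + 1" unfolding m_def using s4 by linarith+
  then have m4: "s / 4 \<le> real m" "1 \<le> m" using s4 by linarith+
  have s2: "real d * s\<^sup>2 = real n" unfolding s_def using d by simp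
  have "real n / real d \<le> real n / 1" using d by (intro divide_left_mono) auto
  then have sn: "s \<le> sqrt (real n)" unfolding s_def by simp
  have "real m * 2 ^ d \<le> (sqrt (real n) / 2) * (2 * x)"
    using m sn pow by (intro mult_mono) auto
  also have "\<dots> = real M" using n0 by (simp add: x_def)
  finally have "real (m * 2 ^ d) \<le> real M" by simp
  then have card: "m * 2 ^ d \<le> M" by (simp only: of_nat_le_iff)
  have "(real m)\<^sup>2 \<le> (s / 2)\<^sup>2" using m by (intro power_mono) auto
  then have "real d * (real m)\<^sup>2 \<le> real d * (s / 2)\<^sup>2" by (intro mult_left_mono) auto
  also have "\<dots> = real n / 4" using s2 by (simp add: power_divide)
  finally have dm2: "real d * (real m)\<^sup>2 \<le> real n / 4" .
  have "real m * 1 \<le> real m * real m" using m4 by (intro mult_left_mono) auto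
  then have "real d * real m \<le> real d * (real m)\<^sup>2"
    unfolding power2_eq_square by (intro mult_left_mono) auto
  then have "real (m * d) < real n" using dm2 n by (simp add: mult.commute)
  then have md: "m * d < n" by (simp only: of_nat_less_iff)
  \<comment> \<open>Here \<open>y < d + 1 \<le> 2 * d\<close> and \<open>n = d * s\<^sup>2\<close>;
    since \<open>m \<ge> s / 4\<close>, the constant 6 suffices because
    \<open>2 \<le> (6 / 4)\<^sup>2\<close>.\<close>
  have "ln (1 + x) \<le> ln (2 * x)" using x by simp
  also have "\<dots> = y * ln 2" unfolding y_def log_def by simp
  also have "\<dots> \<le> y * 1" using y1 ln_2_less_1 by (intro mult_left_mono) auto
  also have "\<dots> \<le> 2 * real d" using d by linarith
  finally have "real n * ln (1 + x) \<le> real n * (2 * real d)" by (intro mult_left_mono) auto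
  also have "\<dots> = 2 * ((real d)\<^sup>2 * s\<^sup>2)" using s2 by (simp add: power2_eq_square algebra_simps)
  also have "\<dots> \<le> 36 / 16 * ((real d)\<^sup>2 * s\<^sup>2)" by (intro mult_right_mono) auto
  also have "\<dots> = (6 * real d * (s / 4))\<^sup>2" by (simp add: power2_eq_square)
  also have "\<dots> \<le> (6 * real d * real m)\<^sup>2"
    using m4(1) s4 by (intro power_mono mult_left_mono) auto
  also have "\<dots> = (6 * real (m * d))\<^sup>2" by (simp add: mult_ac)
  finally have "sqrt (real n * ln (1 + x)) \<le> 6 * real (m * d)"
    by (intro real_le_lsqrt) auto
  then have rate: "real n * convex_rate n M \<le> 6 * real (m * d)"
    using False n by (subst scaled_convex_rate) (auto simp: x_def)
  show ?thesis using m4 d card dm2 md rate by (intro that[of m d]) auto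
qed

section \<open>The dictionary and the hard means\<close>

lemma sum_lessThan_eq_first_block:
  fixes h :: "nat \<Rightarrow> real"
  assumes "D < n" "\<And>i. D < i \<Longrightarrow> h i = 0"
  shows "(\<Sum>i<n. h i) = h 0 + (\<Sum>i\<in>{1..D}. h i)"
proof -
  have "(\<Sum>i<n. h i) = (\<Sum>i\<in>insert 0 {1..D}. h i)"
    using assms by (intro sum.mono_neutral_right) auto
  then show ?thesis by simp
qed

text \<open>Each column has first entry 1 and then \<open>r = a / \<theta>\<close> times a block
  sign vector, so when \<open>y 0 = \<theta>\<close> some aggregate equals the cube mean exactly.
  The two bounds on \<open>2 * a\<close> give \<open>r\<^sup>2 * n \<le> 1\<close>, for the factor 2
  in the oracle loss, and \<open>r\<^sup>2 * n \<le> A\<^sup>2 - 1\<close>, for the operator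
  norm.\<close>

lemma dictionary_exists:
  assumes F: "0 < F" and A: "1 < A" and a: "0 < a" "2 * a \<le> F" "2 * a \<le> F * sqrt (A\<^sup>2 - 1)"
    and md: "0 < m" "m * 2 ^ d \<le> M" "real d * (real m)\<^sup>2 \<le> real n" "m * d < n"
  defines "\<theta> \<equiv> sqrt (real n) * F / 2"
  obtains u where "\<And>j. op_norm n (first_coordinate_mat (u j)) \<le> A"
    and "\<And>T. T \<subseteq> {1..m * d} \<Longrightarrow> \<exists>w\<in>simplex_weights M. \<forall>y.
      loss n (aggregate n M (\<lambda>j. (first_coordinate_mat (u j), \<lambda>_. 0)) w y) (cube_mean n (m * d) \<theta> a T)
        \<le> 2 * (y 0 - \<theta>)\<^sup>2 / real n"
proof -
  define D where "D = m * d"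
  have n: "0 < n" "D < n" using md by (auto simp: D_def)
  have \<theta>: "0 < \<theta>" using n F by (simp add: \<theta>_def)
  obtain V :: "nat \<Rightarrow> nat \<Rightarrow> real" where
    V: "\<And>j. (\<Sum>i\<in>{1..D}. (V j i)\<^sup>2) \<le> (real m)\<^sup>2 * real d" and
    cube: "\<And>T. T \<subseteq> {1..D} \<Longrightarrow> \<exists>w\<in>simplex_weights M. \<forall>i\<in>{1..D}.
        (\<Sum>j<M. w j * V j i) = (if i \<in> T then 1 else - 1)"
    using sign_cube_in_convex_hull[OF md(1,2)] unfolding D_def by blast
  define r where "r = a / \<theta>"
  have r2: "r\<^sup>2 * real n = (2 * a)\<^sup>2 / F\<^sup>2"
    using n F by (simp add: r_def \<theta>_def power_divide power_mult_distrib)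
  have "(2 * a)\<^sup>2 \<le> F\<^sup>2" using a by (intro power_mono) auto
  then have r1: "r\<^sup>2 * real n \<le> 1" unfolding r2 using F by (simp add: divide_le_eq)
  have "(2 * a)\<^sup>2 \<le> (F * sqrt (A\<^sup>2 - 1))\<^sup>2" using a by (intro power_mono) auto
  also have "\<dots> = (A\<^sup>2 - 1) * F\<^sup>2"
    using A by (simp add: power_mult_distrib)
  finally have "r\<^sup>2 * real n \<le> A\<^sup>2 - 1"
    unfolding r2 using F by (subst pos_divide_le_eq) auto
  note r = r1 this
  define u :: "nat \<Rightarrow> rvec" where
    "u j i = (if i = 0 then 1 else if i \<le> D then r * V j i else 0)" for j i
  show thesis
  proof (rule that)
    fix j
    have "(\<Sum>i<n. (u j i)\<^sup>2) = 1 + r\<^sup>2 * (\<Sum>i\<in>{1..D}. (V j i)\<^sup>2)"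
      using n by (subst sum_lessThan_eq_first_block[of D])
        (auto simp: u_def power_mult_distrib sum_distrib_left)
    also have "\<dots> \<le> 1 + r\<^sup>2 * real n"
      using V[of j] md(3) by (intro add_left_mono mult_left_mono) (auto simp: mult.commute)
    also have "\<dots> \<le> A\<^sup>2" using r by simp
    finally have "L2_set (u j) {..<n} \<le> A"
      unfolding L2_set_def using A by (intro real_le_lsqrt sum_nonneg) auto
    then show "op_norm n (first_coordinate_mat (u j)) \<le> A"
      using op_norm_first_coordinate_mat_le[OF n(1), of "u j"] by linarith
  next
    fix T assume "T \<subseteq> {1..m * d}"
    then obtain w where w: "w \<in> simplex_weights M"
      "\<And>i. i \<in> {1..D} \<Longrightarrow> (\<Sum>j<M. w j * V j i) = (if i \<in> T then 1 else - 1)"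
      using cube unfolding D_def by blast
    have "loss n (aggregate n M (\<lambda>j. (first_coordinate_mat (u j), \<lambda>_. 0)) w y) (cube_mean n D \<theta> a T)
        \<le> 2 * (y 0 - \<theta>)\<^sup>2 / real n" for y
    proof -
      \<comment> \<open>The averaged column: the mean is \<open>\<theta> * e\<close> and the
        aggregate \<open>y 0 * e\<close>, so the squared error is
        \<open>(y 0 - \<theta>)\<^sup>2\<close> times
        \<open>1 + r\<^sup>2 * D \<le> 2\<close>.\<close>
      define e where "e i = (if i = 0 then 1 else if i \<le> D then (if i \<in> T then r else - r) else 0)" for i
      have u_w: "(\<Sum>j<M. w j * u j i) = e i" for i
      proof (cases "i \<in> {1..D}")
        case True
        then have "(\<Sum>j<M. w j * u j i) = r * (\<Sum>j<M. w j * V j i)"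
          by (simp add: u_def sum_distrib_left mult_ac)
        then show ?thesis using True w(2) by (simp add: e_def)
      next
        case False
        then consider "i = 0" | "D < i" by force
        then show ?thesis
          using w(1) by cases (simp_all add: u_def e_def simplex_weights_def)
      qed
      have "(aggregate n M (\<lambda>j. (first_coordinate_mat (u j), \<lambda>_. 0)) w y i
          - cube_mean n D \<theta> a T i)\<^sup>2 = (y 0 - \<theta>)\<^sup>2 * (e i)\<^sup>2" if "i < n" for i
      proof -
        have "cube_mean n D \<theta> a T i = \<theta> * e i"
          using that \<theta> by (simp add: cube_mean_def e_def r_def)
        then show ?thesis
          unfolding aggregate_first_coordinate_mat[OF that] u_w
          by (simp only: left_diff_distrib[symmetric] power_mult_distrib)
      qed
      then have "(\<Sum>i<n. (aggregate n M (\<lambda>j. (first_coordinate_mat (u j), \<lambda>_. 0)) w y i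
          - cube_mean n D \<theta> a T i)\<^sup>2) = (\<Sum>i<n. (y 0 - \<theta>)\<^sup>2 * (e i)\<^sup>2)"
        by (intro sum.cong refl) simp
      also have "\<dots> = (y 0 - \<theta>)\<^sup>2 * (\<Sum>i<n. (e i)\<^sup>2)" by (simp add: sum_distrib_left)
      also have "(\<Sum>i<n. (e i)\<^sup>2) = 1 + (\<Sum>i\<in>{1..D}. (e i)\<^sup>2)"
        using n by (subst sum_lessThan_eq_first_block[of D]) (auto simp: e_def)
      also have "(\<Sum>i\<in>{1..D}. (e i)\<^sup>2) = (\<Sum>i\<in>{1..D}. r\<^sup>2)"
        by (intro sum.cong) (auto simp: e_def)
      also have "\<dots> = r\<^sup>2 * real D" by simp
      also have "(y 0 - \<theta>)\<^sup>2 * (1 + r\<^sup>2 * real D) \<le> (y 0 - \<theta>)\<^sup>2 * (1 + r\<^sup>2 * real n)"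
        using n by (intro mult_left_mono add_left_mono) auto
      also have "\<dots> \<le> (y 0 - \<theta>)\<^sup>2 * 2" using r by (intro mult_left_mono) auto
      finally show ?thesis
        unfolding loss_eq by (intro divide_right_mono) auto
    qed
    then show "\<exists>w\<in>simplex_weights M. \<forall>y.
      loss n (aggregate n M (\<lambda>j. (first_coordinate_mat (u j), \<lambda>_. 0)) w y) (cube_mean n (m * d) \<theta> a T)
        \<le> 2 * (y 0 - \<theta>)\<^sup>2 / real n"
      using w(1) unfolding D_def by blast
  qed
qed

text \<open>Coordinate 0 uses a quarter of the budget \<open>n * F\<^sup>2\<close>; the other
  entries are at most \<open>F / 2\<close> in absolute value and use at most another
  quarter.\<close>

lemma cube_mean_in_signal_class:
  assumes F: "0 < F" and a: "0 \<le> a" "2 * a \<le> F" and D: "D < n"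
  shows "cube_mean n D (sqrt (real n) * F / 2) a T \<in> signal_class n F"
proof -
  let ?f = "cube_mean n D (sqrt (real n) * F / 2) a T"
  have a2: "(2 * a)\<^sup>2 \<le> F\<^sup>2" using a by (intro power_mono) auto
  have "(?f i)\<^sup>2 \<le> (if i = 0 then real n * F\<^sup>2 / 4 else 0) + F\<^sup>2 / 4" if "i < n" for i
    using that a2 D by (auto simp: cube_mean_def power_mult_distrib power_divide)
  then have "(\<Sum>i<n. (?f i)\<^sup>2) \<le> (\<Sum>i<n. (if i = 0 then real n * F\<^sup>2 / 4 else 0) + F\<^sup>2 / 4)"
    by (intro sum_mono) auto
  also have "\<dots> = real n * F\<^sup>2 / 4 + real n * F\<^sup>2 / 4"
    using D by (simp add: sum.distrib)
  also have "\<dots> \<le> F\<^sup>2 * real n" by simp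
  finally have "(\<Sum>i<n. (?f i)\<^sup>2) / real n \<le> F\<^sup>2" using D by (simp add: divide_le_eq)
  then have "norm_n n ?f \<le> F"
    unfolding norm_n_def using F by (intro real_le_lsqrt) (auto intro!: divide_nonneg_nonneg sum_nonneg)
  then show ?thesis by (simp add: signal_class_def space_Rn cube_mean_def)
qed

section \<open>From loss to excess loss and excess risk\<close>

lemma estimator_loss_measurable:
  assumes "g \<in> estimators n"
  shows "(\<lambda>y. loss n (g y) f) \<in> borel_measurable (Rn n)"
proof -
  note [measurable] = assms
  show ?thesis unfolding loss_eq by measurable
qed

text \<open>The loss reaches \<open>2 * t\<close> with probability at least \<open>p\<close>, while
  the oracle loss is dominated by a variable of mean at most \<open>p * t / 2\<close>. By Markov's
  inequality the latter reaches \<open>t\<close> with probability at most \<open>p / 2\<close>,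
  which leaves \<open>p / 2\<close> for an excess of \<open>t\<close>. For the risks,
  \<open>2 * p * t - p * t / 2 \<ge> p * t\<close>.\<close>

lemma excess_lower_bounds:
  assumes \<sigma>: "0 < \<sigma>" and n: "0 < n" and M: "0 < M" and g: "g \<in> estimators n"
    and t: "0 < t" and p: "0 \<le> p"
    and w: "w \<in> simplex_weights M"
    and near: "\<And>y. loss n (aggregate n M (\<lambda>j. (first_coordinate_mat (u j), \<lambda>_. 0)) w y) f
        \<le> 2 * (y 0 - f 0)\<^sup>2 / real n"
    and miss: "p \<le> measure (law n \<sigma> f) {y \<in> space (Rn n). 2 * t \<le> loss n (g y) f}"
    and small: "2 * \<sigma>\<^sup>2 / real n \<le> p / 2 * t"
  defines "C \<equiv> \<lambda>j. (first_coordinate_mat (u j), \<lambda>_. 0)"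
  shows "p / 2 \<le> measure (law n \<sigma> f) {y \<in> space (law n \<sigma> f). t \<le> excess_loss n M C g f y}"
    and "ereal (p * t) \<le> excess_risk n M \<sigma> C g f"
proof -
  let ?P = "law n \<sigma> f"
  interpret L: prob_space ?P by (rule prob_space_law[OF \<sigma>])
  let ?I = "\<lambda>y. INF w\<in>simplex_weights M. loss n (aggregate n M C w y) f"
  let ?o = "\<lambda>y. 2 * (y 0 - f 0)\<^sup>2 / real n"
  have [measurable]: "?I \<in> borel_measurable (Rn n)"
    unfolding C_def by (rule borel_measurable_oracle_loss[OF n M])
  have [measurable]: "(\<lambda>y. loss n (g y) f) \<in> borel_measurable (Rn n)"
    by (rule estimator_loss_measurable[OF g])
  have [measurable]: "(\<lambda>y. y 0) \<in> borel_measurable (Rn n)"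
    by (rule measurable_Rn_component[OF n])
  define S where "S = {y \<in> space (Rn n). 2 * t \<le> loss n (g y) f}"
  define Q where "Q = {y \<in> space (Rn n). t \<le> ?o y}"
  define X where "X = {y \<in> space (Rn n). t \<le> excess_loss n M C g f y}"
  have [measurable]: "S \<in> sets (Rn n)" "Q \<in> sets (Rn n)" "X \<in> sets (Rn n)"
    unfolding S_def Q_def X_def excess_loss_def by measurable
  have oracle_risk: "(\<integral>\<^sup>+ y. ennreal (?o y) \<partial>?P) = ennreal (2 * \<sigma>\<^sup>2 / real n)"
  proof -
    have "(\<integral>\<^sup>+ y. ennreal (?o y) \<partial>?P) = (\<integral>\<^sup>+ y. ennreal (2 / real n) * ennreal ((y 0 - f 0)\<^sup>2) \<partial>?P)"
      by (intro nn_integral_cong) (simp add: ennreal_mult'[symmetric])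
    also have "\<dots> = ennreal (2 / real n) * ennreal (\<sigma>\<^sup>2)"
      by (subst nn_integral_cmult) (auto simp: nn_integral_law_square[OF \<sigma> n])
    finally show ?thesis by (simp add: ennreal_mult'[symmetric])
  qed
  have Q: "measure ?P Q \<le> p / 2"
  proof -
    have "ennreal t * emeasure ?P Q = (\<integral>\<^sup>+ y. ennreal t * indicator Q y \<partial>?P)"
      by (simp add: nn_integral_cmult_indicator)
    also have "\<dots> \<le> (\<integral>\<^sup>+ y. ennreal (?o y) \<partial>?P)"
      by (intro nn_integral_mono) (auto simp: indicator_def Q_def intro!: ennreal_leI)
    also have "\<dots> \<le> ennreal (p / 2 * t)"
      unfolding oracle_risk using small by (intro ennreal_leI)
    finally have "ennreal (t * measure ?P Q) \<le> ennreal (p / 2 * t)"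
      using t by (simp add: L.emeasure_eq_measure ennreal_mult')
    then have "t * measure ?P Q \<le> p / 2 * t"
      using t p by (subst (asm) ennreal_le_iff) auto
    then show ?thesis using t by simp
  qed
  have I_le: "?I y \<le> ?o y" for y
  proof -
    have "?I y \<le> loss n (aggregate n M C w y) f"
      using w by (intro cINF_lower bdd_belowI2[where m = 0]) (auto simp: loss_def)
    also have "\<dots> \<le> ?o y" using near unfolding C_def by blast
    finally show ?thesis .
  qed
  have "S \<subseteq> X \<union> Q"
  proof
    fix y assume y: "y \<in> S"
    then show "y \<in> X \<union> Q"
      using I_le[of y] by (auto simp: S_def X_def Q_def excess_loss_def)
  qed
  then have "measure ?P S \<le> measure ?P (X \<union> Q)" by (intro L.finite_measure_mono) auto
  also have "\<dots> \<le> measure ?P X + measure ?P Q" by (intro measure_Un_le) auto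
  finally show "p / 2 \<le> measure ?P {y \<in> space ?P. t \<le> excess_loss n M C g f y}"
    using Q miss by (simp add: S_def[symmetric] X_def[symmetric])
  have "p * (2 * t) \<le> 2 * t * measure ?P S"
    using miss t by (simp add: S_def[symmetric])
  then have "ennreal (p * (2 * t)) \<le> ennreal (2 * t) * emeasure ?P S"
    using t by (simp add: L.emeasure_eq_measure ennreal_mult'[symmetric] ennreal_leI)
  also have "\<dots> = (\<integral>\<^sup>+ y. ennreal (2 * t) * indicator S y \<partial>?P)"
    by (simp add: nn_integral_cmult_indicator)
  also have "\<dots> \<le> risk n \<sigma> g f"
    unfolding risk_def
    by (intro nn_integral_mono) (auto simp: indicator_def S_def intro!: ennreal_leI)
  finally have lower: "ereal (p * (2 * t)) \<le> enn2ereal (risk n \<sigma> g f)"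
    using p t by (simp add: less_eq_ennreal.rep_eq)
  have "(INF w\<in>simplex_weights M. risk n \<sigma> (aggregate n M C w) f) \<le> risk n \<sigma> (aggregate n M C w) f"
    using w by (rule INF_lower)
  also have "\<dots> \<le> (\<integral>\<^sup>+ y. ennreal (?o y) \<partial>?P)"
    unfolding risk_def using near by (intro nn_integral_mono ennreal_leI) (simp add: C_def)
  also have "\<dots> \<le> ennreal (p / 2 * t)"
    unfolding oracle_risk using small by (intro ennreal_leI)
  finally have upper: "enn2ereal (INF w\<in>simplex_weights M. risk n \<sigma> (aggregate n M C w) f) \<le> ereal (p / 2 * t)"
    using p t by (simp add: less_eq_ennreal.rep_eq)
  have "p * t \<le> p * (2 * t) - p / 2 * t" using p t by (simp add: algebra_simps)
  then have "ereal (p * t) \<le> ereal (p * (2 * t)) - ereal (p / 2 * t)" by simp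
  also have "\<dots> \<le> excess_risk n M \<sigma> C g f"
    unfolding excess_risk_def using lower upper by (rule ereal_minus_mono)
  finally show "ereal (p * t) \<le> excess_risk n M \<sigma> C g f" .
qed

section \<open>Choice of constants and the two minimax bounds\<close>

theorem theorem1:
  fixes F A \<sigma>max :: real
  assumes "F > 0" and "A > 1" and "\<sigma>max > 0"
  shows "\<exists>(c0::real) (c1::real) (c2::real) (n0::nat) (M0::nat).
    c0 > 0 \<and> c1 > 0 \<and> c2 > 0 \<and> n0 > 0 \<and> M0 > 0 \<and>
    (\<forall>(\<sigma>::real) (n::nat) (M::nat).
      0 < \<sigma> \<longrightarrow> \<sigma> \<le> \<sigma>max \<longrightarrow> n \<ge> n0 \<longrightarrow> M \<ge> 2 \<longrightarrow> M \<ge> M0 \<longrightarrow> ln (real M) \<le> c0 * real n \<longrightarrow>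
      (\<exists>As :: nat \<Rightarrow> rmat.
        let C = (\<lambda>j. (As j, \<lambda>_. 0)) in
        (\<forall>j<M. op_norm n (As j) \<le> A) \<and>
        (INF g\<in>estimators n. SUP f\<in>signal_class n F.
            measure (law n \<sigma> f)
              {y \<in> space (law n \<sigma> f). excess_loss n M C g f y \<ge> c1 * \<sigma>\<^sup>2 * convex_rate n M})
          \<ge> c2 \<and>
        (INF g\<in>estimators n. SUP f\<in>signal_class n F. excess_risk n M \<sigma> C g f)
          \<ge> ereal (c1 * \<sigma>\<^sup>2 * convex_rate n M)))"
proof -
  \<comment> \<open>\<open>\<kappa>\<close> is the testing constant and \<open>\<alpha>\<close> the
    half side of the cube in units of \<open>\<sigma>\<close>. The three bounds on
    \<open>\<alpha>\<close> give \<open>a \<le> \<sigma>\<close> for Assouad's method and the two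
    dictionary conditions, uniformly in \<open>\<sigma> \<le> \<sigma>max\<close>.\<close>
  define \<kappa> :: real where "\<kappa> = exp (-1) / sqrt 2"
  define \<alpha> where "\<alpha> = min 1 (min (F / (2 * \<sigma>max)) (F * sqrt (A\<^sup>2 - 1) / (2 * \<sigma>max)))"
  \<comment> \<open>\<open>n0\<close> and \<open>M0\<close> make the scaled rate at least
    \<open>K\<close>; as it is at most \<open>6 * D\<close>, the value \<open>768 = 6 * 128\<close>
    yields \<open>D_large\<close>. In \<open>c1\<close>, \<open>192 = 6 * 32\<close> makes
    \<open>c1 * \<sigma>\<^sup>2 * 6 * D / n\<close> equal to
    \<open>\<kappa> / 4 * t\<close>.\<close>
  define K where "K = 768 / (\<kappa>\<^sup>2 * \<alpha>\<^sup>2)"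
  define c1 where "c1 = \<kappa>\<^sup>2 * \<alpha>\<^sup>2 / 192"
  define n0 where "n0 = max 32 (nat \<lceil>2 * K\<^sup>2\<rceil>)"
  define M0 where "M0 = nat \<lceil>K\<rceil>"
  have \<kappa>0: "0 < \<kappa>" by (simp add: \<kappa>_def)
  have "exp (-1) / sqrt 2 \<le> (1 :: real) / 1" by (intro frac_le) auto
  then have \<kappa>1: "\<kappa> \<le> 1" by (simp add: \<kappa>_def)
  have "1 < A\<^sup>2" using assms(2) by (simp add: one_less_power)
  then have \<alpha>0: "0 < \<alpha>" using assms by (simp add: \<alpha>_def)
  have \<alpha>: "\<alpha> \<le> 1" "\<alpha> \<le> F / (2 * \<sigma>max)" "\<alpha> \<le> F * sqrt (A\<^sup>2 - 1) / (2 * \<sigma>max)"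
    by (auto simp: \<alpha>_def)
  have \<alpha>_max: "2 * (\<alpha> * \<sigma>max) \<le> F" "2 * (\<alpha> * \<sigma>max) \<le> F * sqrt (A\<^sup>2 - 1)"
    using \<alpha>(2,3) assms(3) by (simp_all add: le_divide_eq mult_ac)
  have K0: "0 < K" using \<kappa>0 \<alpha>0 by (simp add: K_def)
  have main: "\<exists>As :: nat \<Rightarrow> rmat.
        let C = (\<lambda>j. (As j, \<lambda>_. 0)) in
        (\<forall>j<M. op_norm n (As j) \<le> A) \<and>
        (INF g\<in>estimators n. SUP f\<in>signal_class n F.
            measure (law n \<sigma> f)
              {y \<in> space (law n \<sigma> f). excess_loss n M C g f y \<ge> c1 * \<sigma>\<^sup>2 * convex_rate n M})
          \<ge> \<kappa> / 8 \<and>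
        (INF g\<in>estimators n. SUP f\<in>signal_class n F. excess_risk n M \<sigma> C g f)
          \<ge> ereal (c1 * \<sigma>\<^sup>2 * convex_rate n M)"
    if \<sigma>: "0 < \<sigma>" "\<sigma> \<le> \<sigma>max" and n: "n0 \<le> n" and M: "2 \<le> M" "M0 \<le> M"
      and lnM: "ln (real M) \<le> 1 / 64 * real n" for \<sigma> n M
  proof -
    have n32: "32 \<le> n" and nK: "2 * K\<^sup>2 \<le> real n" and MK: "K \<le> real M"
      using n M(2) unfolding n0_def M0_def by linarith+
    obtain m d where md: "0 < m" "0 < d" "m * 2 ^ d \<le> M" "real d * (real m)\<^sup>2 \<le> real n" "m * d < n"
      and rate: "real n * convex_rate n M \<le> 6 * real (m * d)"
      using block_parameters[OF n32 M(1)] lnM by auto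
    define D where "D = m * d"
    have D: "0 < D" "D < n" using md by (auto simp: D_def)
    have n_pos: "0 < n" "0 < M" using n32 M by auto
    have "K \<le> real n * convex_rate n M"
      using scaled_convex_rate_ge[OF n_pos(1) _ MK nK] K0 by simp
    then have "K \<le> 6 * real D" using rate by (simp add: D_def)
    then have D_large: "128 \<le> real D * \<kappa>\<^sup>2 * \<alpha>\<^sup>2"
      using \<kappa>0 \<alpha>0 by (simp add: K_def divide_le_eq mult_ac)
    define a where "a = \<alpha> * \<sigma>"
    have "a \<le> \<alpha> * \<sigma>max" unfolding a_def using \<sigma> \<alpha>0 by (intro mult_left_mono) auto
    then have a: "2 * a \<le> F" "2 * a \<le> F * sqrt (A\<^sup>2 - 1)"
      using \<alpha>_max by linarith+
    have a0: "0 < a" using \<alpha>0 \<sigma> by (simp add: a_def)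
    have "\<alpha> * \<sigma> \<le> 1 * \<sigma>" using \<alpha> \<sigma> by (intro mult_right_mono) auto
    then have a\<sigma>: "a \<le> \<sigma>" by (simp add: a_def)
    define \<theta> where "\<theta> = sqrt (real n) * F / 2"
    obtain u where op: "\<And>j. op_norm n (first_coordinate_mat (u j)) \<le> A"
      and dict: "\<And>T. T \<subseteq> {1..D} \<Longrightarrow> \<exists>w\<in>simplex_weights M. \<forall>y.
        loss n (aggregate n M (\<lambda>j. (first_coordinate_mat (u j), \<lambda>_. 0)) w y) (cube_mean n D \<theta> a T)
          \<le> 2 * (y 0 - \<theta>)\<^sup>2 / real n"
      using dictionary_exists[OF assms(1,2) a0 a md(1,3,4,5)] unfolding D_def \<theta>_def by blast
    define C where "C = (\<lambda>j. (first_coordinate_mat (u j), (\<lambda>_. 0) :: rvec))"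
    \<comment> \<open>Half of Assouad's loss threshold: the other half is left to the oracle
      loss.\<close>
    define t where "t = real D * \<kappa> * a\<^sup>2 / (8 * real n)"
    have t: "0 < t" using D \<kappa>0 a0 by (simp add: t_def)
    \<comment> \<open>The target must lie below \<open>\<kappa> / 4 * t\<close> for the risk and
      below \<open>t\<close> for the probability.\<close>
    let ?s = "c1 * \<sigma>\<^sup>2 * convex_rate n M"
    have "?s = c1 * \<sigma>\<^sup>2 / real n * (real n * convex_rate n M)" using n_pos by simp
    also have "\<dots> \<le> c1 * \<sigma>\<^sup>2 / real n * (6 * real D)"
      using rate by (intro mult_left_mono) (auto simp: D_def c1_def)
    also have "\<dots> = \<kappa> / 4 * t"
      by (simp add: c1_def t_def a_def power2_eq_square)
    finally have s_pt: "?s \<le> \<kappa> / 4 * t" .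
    also have "\<dots> \<le> 1 * t" using \<kappa>1 t by (intro mult_right_mono) auto
    finally have s_t: "?s \<le> t" by simp
    \<comment> \<open>A rescaling of \<open>D_large\<close>: the cube dimension is large enough to
      make the oracle error of one coordinate negligible.\<close>
    have "2 * \<sigma>\<^sup>2 / real n = \<sigma>\<^sup>2 / (64 * real n) * 128" by simp
    also have "\<dots> \<le> \<sigma>\<^sup>2 / (64 * real n) * (real D * \<kappa>\<^sup>2 * \<alpha>\<^sup>2)"
      using D_large by (intro mult_left_mono) auto
    also have "\<dots> = \<kappa> / 4 / 2 * t"
      by (simp add: t_def a_def power2_eq_square)
    finally have small: "2 * \<sigma>\<^sup>2 / real n \<le> \<kappa> / 4 / 2 * t" .
    \<comment> \<open>The hard mean depends on \<open>g\<close>, whereas the dictionary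
      \<open>C\<close> was fixed before \<open>g\<close>.\<close>
    have hard: "\<exists>f\<in>signal_class n F.
        \<kappa> / 8 \<le> measure (law n \<sigma> f) {y \<in> space (law n \<sigma> f). ?s \<le> excess_loss n M C g f y} \<and>
        ereal ?s \<le> excess_risk n M \<sigma> C g f" if g: "g \<in> estimators n" for g
    proof -
      obtain T where T: "T \<subseteq> {1..D}" "\<kappa> / 4 \<le> measure (law n \<sigma> (cube_mean n D \<theta> a T))
        {y \<in> space (Rn n). real D * \<kappa> / 4 * a\<^sup>2 \<le> (\<Sum>i<n. (g y i - cube_mean n D \<theta> a T i)\<^sup>2)}"
        using assouad_in_probability[OF \<sigma>(1) a0 a\<sigma> D g] unfolding \<kappa>_def by blast
      define f where "f = cube_mean n D \<theta> a T"
      obtain w where w: "w \<in> simplex_weights M"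
        "\<And>y. loss n (aggregate n M (\<lambda>j. (first_coordinate_mat (u j), \<lambda>_. 0)) w y) f
          \<le> 2 * (y 0 - \<theta>)\<^sup>2 / real n"
        using dict[OF T(1)] unfolding f_def by blast
      have f0: "f 0 = \<theta>" using n_pos by (simp add: f_def cube_mean_def)
      have "real D * \<kappa> / 4 * a\<^sup>2 \<le> (\<Sum>i<n. (g y i - f i)\<^sup>2) \<longleftrightarrow> 2 * t \<le> loss n (g y) f" for y
        using n_pos by (simp add: loss_eq t_def le_divide_eq mult_ac)
      then have miss: "\<kappa> / 4 \<le> measure (law n \<sigma> f) {y \<in> space (Rn n). 2 * t \<le> loss n (g y) f}"
        using T(2) unfolding f_def by simp
      interpret L: prob_space "law n \<sigma> f" by (rule prob_space_law[OF \<sigma>(1)])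
      note bounds = excess_lower_bounds[OF \<sigma>(1) n_pos g t _ w[folded f0] miss small, folded C_def]
      have [measurable]: "(\<lambda>y. loss n (g y) f) \<in> borel_measurable (Rn n)"
        by (rule estimator_loss_measurable[OF g])
      have [measurable]: "(\<lambda>y. excess_loss n M C g f y) \<in> borel_measurable (Rn n)"
        unfolding excess_loss_def C_def
        using borel_measurable_oracle_loss[OF n_pos] by measurable
      have "\<kappa> / 4 / 2 \<le> measure (law n \<sigma> f) {y \<in> space (law n \<sigma> f). t \<le> excess_loss n M C g f y}"
        using bounds(1) \<kappa>0 by simp
      also have "\<dots> \<le> measure (law n \<sigma> f) {y \<in> space (law n \<sigma> f). ?s \<le> excess_loss n M C g f y}"
        using s_t by (intro L.finite_measure_mono) auto
      finally have "\<kappa> / 8 \<le> measure (law n \<sigma> f) {y \<in> space (law n \<sigma> f). ?s \<le> excess_loss n M C g f y}"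
        by simp
      moreover have "ereal ?s \<le> excess_risk n M \<sigma> C g f"
        using bounds(2) \<kappa>0 s_pt by (intro order_trans[OF _ bounds(2)]) auto
      moreover have "f \<in> signal_class n F"
        unfolding f_def \<theta>_def using assms(1) a0 a D by (intro cube_mean_in_signal_class) auto
      ultimately show ?thesis by blast
    qed
    \<comment> \<open>For real-valued extrema, nonemptiness and boundedness have to be supplied: the
      identity is an estimator, and probabilities are at most 1.\<close>
    have "\<kappa> / 8 \<le> (INF g\<in>estimators n. SUP f\<in>signal_class n F.
        measure (law n \<sigma> f) {y \<in> space (law n \<sigma> f). ?s \<le> excess_loss n M C g f y})"
    proof (rule cINF_greatest)
      have "(\<lambda>y. y) \<in> estimators n" by (simp add: estimators_def)
      then show "estimators n \<noteq> {}" by blast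
    next
      fix g assume "g \<in> estimators n"
      then obtain f where f: "f \<in> signal_class n F"
        "\<kappa> / 8 \<le> measure (law n \<sigma> f) {y \<in> space (law n \<sigma> f). ?s \<le> excess_loss n M C g f y}"
        using hard by blast
      then show "\<kappa> / 8 \<le> (SUP f\<in>signal_class n F.
          measure (law n \<sigma> f) {y \<in> space (law n \<sigma> f). ?s \<le> excess_loss n M C g f y})"
        using prob_space.prob_le_1[OF prob_space_law[OF \<sigma>(1)]]
        by (intro cSUP_upper2[where x = f] bdd_aboveI2[where M = 1]) auto
    qed
    moreover have "ereal ?s \<le> (INF g\<in>estimators n. SUP f\<in>signal_class n F. excess_risk n M \<sigma> C g f)"
      using hard by (intro INF_greatest) (meson SUP_upper2)
    ultimately show ?thesis
      using op unfolding C_def by (intro exI[of _ "\<lambda>j. first_coordinate_mat (u j)"]) (simp add: Let_def)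
  qed
  have "0 < n0" by (simp add: n0_def)
  moreover have "0 < M0" using K0 by (simp add: M0_def)
  moreover have "0 < c1" using \<kappa>0 \<alpha>0 by (simp add: c1_def)
  ultimately show ?thesis
    using \<kappa>0 main by (intro exI[of _ "1 / 64"] exI[of _ c1] exI[of _ "\<kappa> / 8"] exI[of _ n0] exI[of _ M0]) auto
qed

end
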